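(* Let $\mathcal{J}$ be a finite set of products partitioned among firms $f\in\mathcal F$ by nonempty sets $\mathcal J_f$, with demand either multinomial logit (MNL) with parameters $\alpha>0$, $N>0$, or CES with parameters $\sigma>1$, $Y>0$, and let $p^{\mathrm{pre}}$ be a (pre-merger) Bertrand–Nash equilibrium. Suppose two distinct firms $A$ and $B$ merge, and there is no merger-specific synergy (marginal costs are unchanged). Let $M$ be the merger pass-through matrix. Then the first-order approximation $\Delta \mathit{CS}$ to the merger-induced change in consumer surplus (as defined in the context) is $$\Delta \mathit{CS} = -V_0\,\rho_1\,\rho_2\,\Delta \mathit{HHI}_{AB},\qquad \Delta \mathit{HHI}_{AB}=2 s_A s_B ,$$ where shares are quantity shares under MNL and revenue shares under CES (all evaluated at $p^{\mathrm{pre}}$), and: (MNL) $V_0=\dfrac{N}{\alpha}$, $\quad\rho_1=\dfrac{1}{(1-s_A)(1-s_B)}$, $$\rho_2=\sum_{j,l\in\mathcal J_A\cup\mathcal J_B} M_{jl}\,\frac{s_j}{s_l}\left(\frac12\,\mathbb I_{l\in\mathcal J_A}\frac{s_l/(1-s_l)}{s_A/(1-s_A)}+\frac12\,\mathbb I_{l\in\mathcal J_B}\frac{s_l/(1-s_l)}{s_B/(1-s_B)}\right);$$ (CES) $V_0=\dfrac{Y}{\sigma-1}$, $\quad\rho_1=\dfrac{\frac{\sigma}{\sigma-1}}{\left(\frac{\sigma}{\sigma-1}-s_A\right)\left(\frac{\sigma}{\sigma-1}-s_B\right)}$, $$\rho_2=\sum_{j,l\in\mathcal J_A\cup\mathcal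 J_B} \frac{\sigma-1}{\sigma}\,M_{jl}\,\frac{s_j}{s_l}\left(\frac12\,\mathbb I_{l\in\mathcal J_A}\frac{s_l/(\frac{\sigma}{\sigma-1}-s_l)}{s_A/(\frac{\sigma}{\sigma-1}-s_A)}+\frac12\,\mathbb I_{l\in\mathcal J_B}\frac{s_l/(\frac{\sigma}{\sigma-1}-s_l)}{s_B/(\frac{\sigma}{\sigma-1}-s_B)}\right).$$
   Context: Pricing game. Each product $l\in\mathcal J$ has price $p_l>0$ and constant marginal cost $c_l>0$. Firm $f$'s profit is $\Pi_f(p)=\sum_{l\in\mathcal J_f}(p_l-c_l)q_l(p)$. Demand is $$q_j(p)=\frac{\exp(v_j-\alpha p_j)}{1+\sum_{l\in\mathcal J}\exp(v_l-\alpha p_l)}N\ \ (\text{MNL},\ v_j\in\mathbb R),\qquad q_j(p)=\frac{v_jp_j^{-\sigma}}{1+\sum_{l\in\mathcal J}v_lp_l^{1-\sigma}}Y\ \ (\text{CES},\ v_j>0).$$ A Bertrand–Nash equilibrium is a price vector at which each firm's own prices maximize its profit given the others' prices (so all firms' first-order conditions hold). $p^{\mathrm{pre}}$ denotes the equilibrium with firms $A$ and $B$ separate. Shares. Under MNL, $s_j=q_j/N$ (quantity share); under CES, $s_j=p_jq_j/Y$ (revenue share). Firm shares are $s_f=\sum_{j\in\mathcal J_f}s_j$. $\mathbb I$ denotes the indicator. Upward pricing pressure. The diversion ratio is $D_{j\to l}=-(\partial q_l/\partial p_j)/(\partial q_j/\partial p_j)$. For $j\in\mathcal J_A$, $\mathit{UPP}_j=\sum_{l\in\mathcal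 J_B}(p_l-c_l)D_{j\to l}$; for $j\in\mathcal J_B$, $\mathit{UPP}_j=\sum_{l\in\mathcal J_A}(p_l-c_l)D_{j\to l}$; $\mathit{GUPPI}_j=\mathit{UPP}_j/p_j$. All evaluated at $p^{\mathrm{pre}}$. Merger pass-through matrix $M$ (indexed by $\mathcal J_A\cup\mathcal J_B$). MNL: for $j\in\mathcal J_A\cup\mathcal J_B$ let $$h_j(p)=-q_j\Big(\frac{\partial q_j}{\partial p_j}\Big)^{-1}-(p_j-c_j)-\sum_{l\in(\mathcal J_A\cup\mathcal J_B)\setminus\{j\}}(p_l-c_l)\frac{\partial q_l}{\partial p_j}\Big(\frac{\partial q_j}{\partial p_j}\Big)^{-1},$$ so that $h=0$ is the merged firm's first-order condition; $M=-\big(\partial h_j/\partial p_k\big)_{j,k\in\mathcal J_A\cup\mathcal J_B}^{-1}$ at $p^{\mathrm{pre}}$. CES: with $\tilde p_j=\log p_j$, $m_j=(p_j-c_j)/p_j$, $\varepsilon_{jj}=(\partial q_j/\partial p_j)(p_j/q_j)$, $R_j=p_jq_j$, $D^R_{j\to l}=-(\partial R_l/\partial p_j)/(\partial R_j/\partial p_j)$, let $$h_j(\tilde p)=-\varepsilon_{jj}^{-1}-m_j+(1+\varepsilon_{jj}^{-1})\sum_{l\in(\mathcal J_A\cup\mathcal J_B)\setminus\{j\}}m_lD^R_{j\to l};$$ $M=-\big(\partial h_j/\partial\tilde p_k\big)_{j,k\in\mathcal J_A\cup\mathcal J_B}^{-1}$ at $\tilde p^{\mathrm{pre}}$. In both cases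 the Jacobian is assumed invertible, so that $M$ is defined. First-order approximation to the change in consumer surplus. $\Delta\mathit{CS}=-\sum_{j\in\mathcal J_A\cup\mathcal J_B}\Delta p_j\,q_j(p^{\mathrm{pre}})$, where the first-order predicted price changes are $\Delta p_j=\sum_{k\in\mathcal J_A\cup\mathcal J_B}M_{jk}\mathit{UPP}_k$ under MNL, and $\Delta p_j/p_j^{\mathrm{pre}}=\sum_{k\in\mathcal J_A\cup\mathcal J_B}M_{jk}\mathit{GUPPI}_k$ under CES. *)

theory Defs
  imports "HOL-Analysis.Analysis"
begin

text \<open>
  Products are elements of a type \<open>'j\<close>, the product set is an explicit finite set \<open>J\<close>, and vectors
  indexed by products are functions on \<open>'j\<close> of which only the values on \<open>J\<close> matter. A demand system
  is a function \<open>q\<close> with \<open>q p l\<close> the quantity of product \<open>l\<close> at the price vector \<open>p\<close>.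
\<close>

definition product_partition :: "'j set \<Rightarrow> 'f set \<Rightarrow> ('f \<Rightarrow> 'j set) \<Rightarrow> bool" where
  "product_partition J F Jf \<longleftrightarrow>
     disjoint_family_on Jf F \<and> (\<Union>f\<in>F. Jf f) = J \<and> (\<forall>f\<in>F. Jf f \<noteq> {})"

definition partial :: "(('j \<Rightarrow> real) \<Rightarrow> real) \<Rightarrow> 'j \<Rightarrow> ('j \<Rightarrow> real) \<Rightarrow> real" where
  "partial G k p = deriv (\<lambda>x. G (p(k := x))) (p k)"


subsection \<open>Demand, profit, equilibrium\<close>

definition mnl_demand :: "'j set \<Rightarrow> real \<Rightarrow> real \<Rightarrow> ('j \<Rightarrow> real) \<Rightarrow> ('j \<Rightarrow> real) \<Rightarrow> 'j \<Rightarrow> real" where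
  "mnl_demand J \<alpha> N v p j =
     exp (v j - \<alpha> * p j) / (1 + (\<Sum>l\<in>J. exp (v l - \<alpha> * p l))) * N"

definition ces_demand :: "'j set \<Rightarrow> real \<Rightarrow> real \<Rightarrow> ('j \<Rightarrow> real) \<Rightarrow> ('j \<Rightarrow> real) \<Rightarrow> 'j \<Rightarrow> real" where
  "ces_demand J \<sigma> Y v p j =
     v j * p j powr (- \<sigma>) / (1 + (\<Sum>l\<in>J. v l * p l powr (1 - \<sigma>))) * Y"

definition profit ::
    "(('j \<Rightarrow> real) \<Rightarrow> 'j \<Rightarrow> real) \<Rightarrow> ('j \<Rightarrow> real) \<Rightarrow> 'j set \<Rightarrow> ('j \<Rightarrow> real) \<Rightarrow> real" where
  "profit q c S p = (\<Sum>l\<in>S. (p l - c l) * q p l)"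

definition bertrand_nash ::
    "(('j \<Rightarrow> real) \<Rightarrow> 'j \<Rightarrow> real) \<Rightarrow> ('j \<Rightarrow> real) \<Rightarrow> 'j set \<Rightarrow> 'f set \<Rightarrow> ('f \<Rightarrow> 'j set) \<Rightarrow>
     ('j \<Rightarrow> real) \<Rightarrow> bool" where
  "bertrand_nash q c J F Jf p \<longleftrightarrow>
     (\<forall>l\<in>J. 0 < p l) \<and>
     (\<forall>f\<in>F. \<forall>p'. (\<forall>l\<in>J. 0 < p' l) \<and> (\<forall>l\<in>J - Jf f. p' l = p l) \<longrightarrow>
        profit q c (Jf f) p' \<le> profit q c (Jf f) p)"

definition mnl_share :: "(('j \<Rightarrow> real) \<Rightarrow> 'j \<Rightarrow> real) \<Rightarrow> real \<Rightarrow> ('j \<Rightarrow> real) \<Rightarrow> 'j \<Rightarrow> real" where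
  "mnl_share q N p j = q p j / N"

definition ces_share :: "(('j \<Rightarrow> real) \<Rightarrow> 'j \<Rightarrow> real) \<Rightarrow> real \<Rightarrow> ('j \<Rightarrow> real) \<Rightarrow> 'j \<Rightarrow> real" where
  "ces_share q Y p j = p j * q p j / Y"


subsection \<open>Upward pricing pressure\<close>

definition diversion ::
    "(('j \<Rightarrow> real) \<Rightarrow> 'j \<Rightarrow> real) \<Rightarrow> ('j \<Rightarrow> real) \<Rightarrow> 'j \<Rightarrow> 'j \<Rightarrow> real" where
  "diversion q p j l = - partial (\<lambda>p. q p l) j p / partial (\<lambda>p. q p j) j p"

text \<open>\<open>SA\<close> and \<open>SB\<close> are the product sets of the merging firms; \<open>j\<close> is meant to range over
  \<open>SA \<union> SB\<close>, the two sets being disjoint.\<close>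

definition UPP ::
    "(('j \<Rightarrow> real) \<Rightarrow> 'j \<Rightarrow> real) \<Rightarrow> ('j \<Rightarrow> real) \<Rightarrow> 'j set \<Rightarrow> 'j set \<Rightarrow> ('j \<Rightarrow> real) \<Rightarrow> 'j \<Rightarrow> real"
  where
  "UPP q c SA SB p j =
     (\<Sum>l\<in>(if j \<in> SA then SB else SA). (p l - c l) * diversion q p j l)"

definition GUPPI ::
    "(('j \<Rightarrow> real) \<Rightarrow> 'j \<Rightarrow> real) \<Rightarrow> ('j \<Rightarrow> real) \<Rightarrow> 'j set \<Rightarrow> 'j set \<Rightarrow> ('j \<Rightarrow> real) \<Rightarrow> 'j \<Rightarrow> real"
  where
  "GUPPI q c SA SB p j = UPP q c SA SB p j / p j"


subsection \<open>Matrices indexed by a finite set\<close>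

text \<open>The analogues of \<open>invertible\<close> and \<open>matrix_inv\<close> for square matrices whose index set is a
  subset \<open>S\<close> of a type; entries outside \<open>S \<times> S\<close> are irrelevant.\<close>

definition is_inverse_on ::
    "'j set \<Rightarrow> ('j \<Rightarrow> 'j \<Rightarrow> real) \<Rightarrow> ('j \<Rightarrow> 'j \<Rightarrow> real) \<Rightarrow> bool" where
  "is_inverse_on S X Z \<longleftrightarrow>
     (\<forall>j\<in>S. \<forall>k\<in>S. (\<Sum>l\<in>S. X j l * Z l k) = of_bool (j = k) \<and>
                  (\<Sum>l\<in>S. Z j l * X l k) = of_bool (j = k))"

definition invertible_on :: "'j set \<Rightarrow> ('j \<Rightarrow> 'j \<Rightarrow> real) \<Rightarrow> bool" where
  "invertible_on S X \<longleftrightarrow> (\<exists>Z. is_inverse_on S X Z)"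

definition matrix_inv_on :: "'j set \<Rightarrow> ('j \<Rightarrow> 'j \<Rightarrow> real) \<Rightarrow> 'j \<Rightarrow> 'j \<Rightarrow> real" where
  "matrix_inv_on S X = (SOME Z. is_inverse_on S X Z)"


subsection \<open>Merger pass-through\<close>

text \<open>Throughout, \<open>S\<close> is the set of products of the merged firm.\<close>

definition mnl_h ::
    "(('j \<Rightarrow> real) \<Rightarrow> 'j \<Rightarrow> real) \<Rightarrow> ('j \<Rightarrow> real) \<Rightarrow> 'j set \<Rightarrow> 'j \<Rightarrow> ('j \<Rightarrow> real) \<Rightarrow> real" where
  "mnl_h q c S j p =
     - q p j * inverse (partial (\<lambda>p. q p j) j p) - (p j - c j)
     - (\<Sum>l\<in>S - {j}. (p l - c l) * partial (\<lambda>p. q p l) j p * inverse (partial (\<lambda>p. q p j) j p))"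

definition mnl_jacobian ::
    "(('j \<Rightarrow> real) \<Rightarrow> 'j \<Rightarrow> real) \<Rightarrow> ('j \<Rightarrow> real) \<Rightarrow> 'j set \<Rightarrow> ('j \<Rightarrow> real) \<Rightarrow> 'j \<Rightarrow> 'j \<Rightarrow> real" where
  "mnl_jacobian q c S p j k = partial (mnl_h q c S j) k p"

definition mnl_pass_through ::
    "(('j \<Rightarrow> real) \<Rightarrow> 'j \<Rightarrow> real) \<Rightarrow> ('j \<Rightarrow> real) \<Rightarrow> 'j set \<Rightarrow> ('j \<Rightarrow> real) \<Rightarrow> 'j \<Rightarrow> 'j \<Rightarrow> real" where
  "mnl_pass_through q c S p j k = - matrix_inv_on S (mnl_jacobian q c S p) j k"

definition own_elasticity ::
    "(('j \<Rightarrow> real) \<Rightarrow> 'j \<Rightarrow> real) \<Rightarrow> ('j \<Rightarrow> real) \<Rightarrow> 'j \<Rightarrow> real" where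
  "own_elasticity q p j = partial (\<lambda>p. q p j) j p * (p j / q p j)"

definition revenue :: "(('j \<Rightarrow> real) \<Rightarrow> 'j \<Rightarrow> real) \<Rightarrow> ('j \<Rightarrow> real) \<Rightarrow> 'j \<Rightarrow> real" where
  "revenue q p j = p j * q p j"

definition relative_margin :: "('j \<Rightarrow> real) \<Rightarrow> ('j \<Rightarrow> real) \<Rightarrow> 'j \<Rightarrow> real" where
  "relative_margin c p j = (p j - c j) / p j"

text \<open>\<open>t\<close> is the vector of log prices; \<open>diversion (revenue q)\<close> is the revenue diversion ratio.\<close>

definition ces_h ::
    "(('j \<Rightarrow> real) \<Rightarrow> 'j \<Rightarrow> real) \<Rightarrow> ('j \<Rightarrow> real) \<Rightarrow> 'j set \<Rightarrow> 'j \<Rightarrow> ('j \<Rightarrow> real) \<Rightarrow> real" where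
  "ces_h q c S j t =
     (let p = (\<lambda>l. exp (t l)); \<epsilon> = own_elasticity q p j
      in - inverse \<epsilon> - relative_margin c p j
         + (1 + inverse \<epsilon>) *
             (\<Sum>l\<in>S - {j}. relative_margin c p l * diversion (revenue q) p j l))"

definition ces_jacobian ::
    "(('j \<Rightarrow> real) \<Rightarrow> 'j \<Rightarrow> real) \<Rightarrow> ('j \<Rightarrow> real) \<Rightarrow> 'j set \<Rightarrow> ('j \<Rightarrow> real) \<Rightarrow> 'j \<Rightarrow> 'j \<Rightarrow> real" where
  "ces_jacobian q c S p j k = partial (ces_h q c S j) k (\<lambda>l. ln (p l))"

definition ces_pass_through ::
    "(('j \<Rightarrow> real) \<Rightarrow> 'j \<Rightarrow> real) \<Rightarrow> ('j \<Rightarrow> real) \<Rightarrow> 'j set \<Rightarrow> ('j \<Rightarrow> real) \<Rightarrow> 'j \<Rightarrow> 'j \<Rightarrow> real" where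
  "ces_pass_through q c S p j k = - matrix_inv_on S (ces_jacobian q c S p) j k"


subsection \<open>First-order change in consumer surplus\<close>

definition mnl_price_change ::
    "(('j \<Rightarrow> real) \<Rightarrow> 'j \<Rightarrow> real) \<Rightarrow> ('j \<Rightarrow> real) \<Rightarrow> 'j set \<Rightarrow> 'j set \<Rightarrow> ('j \<Rightarrow> real) \<Rightarrow> 'j \<Rightarrow> real"
  where
  "mnl_price_change q c SA SB p j =
     (\<Sum>k\<in>SA \<union> SB. mnl_pass_through q c (SA \<union> SB) p j k * UPP q c SA SB p k)"

definition ces_price_change ::
    "(('j \<Rightarrow> real) \<Rightarrow> 'j \<Rightarrow> real) \<Rightarrow> ('j \<Rightarrow> real) \<Rightarrow> 'j set \<Rightarrow> 'j set \<Rightarrow> ('j \<Rightarrow> real) \<Rightarrow> 'j \<Rightarrow> real"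
  where
  "ces_price_change q c SA SB p j =
     p j * (\<Sum>k\<in>SA \<union> SB. ces_pass_through q c (SA \<union> SB) p j k * GUPPI q c SA SB p k)"

definition delta_CS ::
    "(('j \<Rightarrow> real) \<Rightarrow> 'j \<Rightarrow> real) \<Rightarrow> 'j set \<Rightarrow> ('j \<Rightarrow> real) \<Rightarrow> ('j \<Rightarrow> real) \<Rightarrow> real" where
  "delta_CS q S p \<Delta>p = - (\<Sum>j\<in>S. \<Delta>p j * q p j)"

end

theory Submission
  imports Defs
begin

text \<open>
  Both demands have the form \<open>b\<^sub>l(p\<^sub>l) / (1 + \<Sum>\<^sub>i a\<^sub>i(p\<^sub>i))\<close>, and their equilibrium conditions say that
  the margin (relative margin under CES) \<open>m\<^sub>j\<close> of a product of firm \<open>f\<close> satisfies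
  \<open>\<kappa> m\<^sub>j = a + \<Sum>\<^sub>l m\<^sub>l s\<^sub>l\<close>, the sum being over the products of \<open>f\<close>, with \<open>\<kappa> = 1\<close>, \<open>a = 1/\<alpha>\<close> under MNL
  and \<open>\<kappa> = \<sigma>/(\<sigma> - 1)\<close>, \<open>a = 1/(\<sigma> - 1)\<close> under CES. Hence margins are uniform within a firm and
  \<open>\<Sum>\<^sub>l m\<^sub>l s\<^sub>l = a s\<^sub>f / (\<kappa> - s\<^sub>f)\<close>. The pricing pressure (UPP, respectively GUPPI) on a product \<open>j\<close> of one
  merging firm is this sum for the other firm divided by \<open>\<kappa> - s\<^sub>j\<close>; with it, the two sides of the
  formula agree in the coefficient of each entry of \<open>M\<close>.
\<close>

section \<open>First-order conditions at an equilibrium\<close>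

text \<open>Replacing the single price \<open>p j\<close> by a positive \<open>x\<close> is an
  admissible deviation of firm \<open>f\<close>. Its profit along this line is therefore maximal at
  \<open>p j\<close>, and the derivative there, computed by the product rule, vanishes.\<close>

lemma bertrand_nash_foc:
  fixes q :: "('j \<Rightarrow> real) \<Rightarrow> 'j \<Rightarrow> real"
  assumes eq: "bertrand_nash q c J F Jf p"
    and f: "f \<in> F" and fin: "finite (Jf f)" and sub: "Jf f \<subseteq> J" and j: "j \<in> Jf f"
    and d: "\<And>l. l \<in> Jf f \<Longrightarrow> ((\<lambda>x. q (p(j := x)) l) has_real_derivative d l) (at (p j))"
  shows "q p j + (\<Sum>l\<in>Jf f. (p l - c l) * d l) = 0"
proof -
  let ?g = "\<lambda>x. profit q c (Jf f) (p(j := x))"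
  have pos: "0 < p l" if "l \<in> J" for l
    using eq that by (auto simp: bertrand_nash_def)
  have pj: "0 < p j" using pos j sub by blast
  have "(?g has_real_derivative
          (\<Sum>l\<in>Jf f. of_bool (l = j) * q p l + (p l - c l) * d l)) (at (p j))"
    unfolding profit_def
  proof (rule DERIV_sum)
    fix l assume l: "l \<in> Jf f"
    have "((\<lambda>x. (p(j := x)) l - c l) has_real_derivative of_bool (l = j)) (at (p j))"
      by (cases "l = j") (auto intro!: derivative_eq_intros)
    from DERIV_mult[OF this d[OF l]]
    show "((\<lambda>x. ((p(j := x)) l - c l) * q (p(j := x)) l) has_real_derivative
            of_bool (l = j) * q p l + (p l - c l) * d l) (at (p j))"
      by (simp add: algebra_simps)
  qed
  \<comment> \<open>The radius \<open>p j\<close> around \<open>p j\<close> is chosen so that the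
    deviating price stays positive.\<close>
  moreover have "?g x \<le> ?g (p j)" if "\<bar>p j - x\<bar> < p j" for x
  proof -
    have "0 < x" using that by linarith
    then have "(\<forall>l\<in>J. 0 < (p(j := x)) l) \<and> (\<forall>l\<in>J - Jf f. (p(j := x)) l = p l)"
      using pos j by auto
    then show ?thesis using eq f unfolding bertrand_nash_def by (simp add: fun_upd_triv)
  qed
  ultimately have "(\<Sum>l\<in>Jf f. of_bool (l = j) * q p l + (p l - c l) * d l) = 0"
    using DERIV_local_max[of ?g _ "p j" "p j"] pj by blast
  then show ?thesis
    using fin j by (simp add: sum.distrib of_bool_def if_distrib[of "\<lambda>x. x * _"] cong: if_cong)
qed

section \<open>Price derivatives of the two demands\<close>

text \<open>The price of \<open>j\<close> enters the numerator for \<open>l\<close> only if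
  \<open>l = j\<close>, but it always enters the common denominator, so the quotient rule gives two
  terms. The families \<open>a\<close> and \<open>b\<close> are kept apart because under CES they
  have the exponents \<open>1 - \<sigma>\<close> and \<open>- \<sigma>\<close>; under MNL they
  coincide.\<close>

lemma attraction_demand_deriv:
  fixes a b :: "'j \<Rightarrow> real \<Rightarrow> real"
  assumes "finite J" and "j \<in> J"
    and a: "(a j has_real_derivative a') (at (p j))"
    and b: "(b j has_real_derivative b') (at (p j))"
    and D: "D = 1 + (\<Sum>i\<in>J. a i (p i))" "D \<noteq> 0"
  shows "((\<lambda>x. b l ((p(j := x)) l) / (1 + (\<Sum>i\<in>J. a i ((p(j := x)) i))) * N)
           has_real_derivative (of_bool (l = j) * b' / D - b l (p l) * a' / D\<^sup>2) * N) (at (p j))"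
proof -
  have upd: "((\<lambda>x. g i ((p(j := x)) i)) has_real_derivative of_bool (i = j) * g') (at (p j))"
    if "(g j has_real_derivative g') (at (p j))" for g :: "'j \<Rightarrow> real \<Rightarrow> real" and g' i
    using that by (cases "i = j") auto
  have "((\<lambda>x. \<Sum>i\<in>J. a i ((p(j := x)) i)) has_real_derivative (\<Sum>i\<in>J. of_bool (i = j) * a')) (at (p j))"
    by (intro DERIV_sum upd a)
  then have "((\<lambda>x. \<Sum>i\<in>J. a i ((p(j := x)) i)) has_real_derivative a') (at (p j))"
    using assms(1,2) by (simp add: of_bool_def if_distrib[of "\<lambda>x. x * _"] cong: if_cong)
  from DERIV_add[OF DERIV_const this] have S: "((\<lambda>x. 1 + (\<Sum>i\<in>J. a i ((p(j := x)) i))) has_real_derivative a') (at (p j))"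
    by simp
  show ?thesis
    by (rule DERIV_cong[OF DERIV_cmult_right[OF DERIV_divide[OF upd[of b, OF b] S]]])
      (use D(2) in \<open>simp_all add: fun_upd_triv power2_eq_square field_simps flip: D(1)\<close>)
qed

lemma mnl_demand_deriv:
  fixes \<alpha> :: real and v :: "'j \<Rightarrow> real"
  assumes "finite J" and "j \<in> J" and "N \<noteq> 0"
  defines "q \<equiv> mnl_demand J \<alpha> N v"
  shows "((\<lambda>x. q (p(j := x)) l) has_real_derivative
           \<alpha> * q p l * (mnl_share q N p j - of_bool (l = j))) (at (p j))"
proof -
  let ?e = "\<lambda>l x. exp (v l - \<alpha> * x)"
  define D where "D = 1 + (\<Sum>i\<in>J. ?e i (p i))"
  have D0: "D \<noteq> 0"
    unfolding D_def by (smt (verit) exp_gt_zero sum_nonneg)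
  have e: "(?e j has_real_derivative - \<alpha> * ?e j (p j)) (at (p j))"
    by (auto intro!: derivative_eq_intros)
  have q: "q p i = ?e i (p i) / D * N" for i
    by (simp add: q_def mnl_demand_def D_def)
  show ?thesis
    \<comment> \<open>The fact \<open>q\<close> rewrites demand at the fixed point \<open>p\<close>
      only, in terms of \<open>D\<close>. Demand at the moving point is opened afterwards, with its
      denominator explicit as the quotient rule requires.\<close>
    unfolding q mnl_share_def
    unfolding q_def mnl_demand_def
    by (rule DERIV_cong[OF attraction_demand_deriv[where a = ?e and b = ?e, OF assms(1,2) e e D_def D0]])
      (use D0 assms(3) in \<open>auto simp: field_simps power2_eq_square\<close>)
qed

lemma ces_demand_deriv:
  fixes \<sigma> :: real and v :: "'j \<Rightarrow> real"
  assumes "finite J" and "j \<in> J" and "Y \<noteq> 0" and pos: "\<forall>l\<in>J. 0 < p l" "\<forall>l\<in>J. 0 < v l"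
  defines "q \<equiv> ces_demand J \<sigma> Y v"
  shows "((\<lambda>x. q (p(j := x)) l) has_real_derivative
           q p l / p j * ((\<sigma> - 1) * ces_share q Y p j - \<sigma> * of_bool (l = j))) (at (p j))"
proof -
  let ?a = "\<lambda>l x. v l * x powr (1 - \<sigma>)" and ?b = "\<lambda>l x. v l * x powr (- \<sigma>)"
  define D where "D = 1 + (\<Sum>i\<in>J. ?a i (p i))"
  have D0: "D \<noteq> 0"
    unfolding D_def using pos by (smt (verit) mult_nonneg_nonneg powr_ge_zero sum_nonneg)
  have pj: "0 < p j" using pos assms(2) by blast
  \<comment> \<open>The derivative of the denominator is a multiple of the numerator of
    \<open>j\<close>; this is how the revenue share of \<open>j\<close> enters.\<close>
  have a: "(?a j has_real_derivative (1 - \<sigma>) * ?b j (p j)) (at (p j))"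
    using pj by (auto intro!: derivative_eq_intros)
  have b: "(?b j has_real_derivative - \<sigma> * ?b j (p j) / p j) (at (p j))"
    using pj by (auto intro!: derivative_eq_intros simp: powr_diff)
  have q: "q p i = ?b i (p i) / D * Y" for i
    by (simp add: q_def ces_demand_def D_def)
  show ?thesis
    unfolding q ces_share_def
    unfolding q_def ces_demand_def
    by (rule DERIV_cong[OF attraction_demand_deriv[where a = ?a and b = ?b, OF assms(1,2) a b D_def D0]])
      (use D0 pj assms(3) in \<open>auto simp: field_simps power2_eq_square\<close>)
qed

section \<open>Positivity of shares and bounds on their sums\<close>

text \<open>The summand 1 in the denominator is the outside option: with \<open>W\<close> the sum of
  all weights, the shares over \<open>J\<close> add up to \<open>W / (1 + W)\<close>, which is below
  1, and positivity passes the bound to subsets.\<close>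

lemma attraction_shares:
  fixes w :: "'j \<Rightarrow> real"
  assumes "finite J" and "\<And>l. l \<in> J \<Longrightarrow> 0 < w l"
    and s: "\<And>l. l \<in> J \<Longrightarrow> s l = w l / (1 + (\<Sum>i\<in>J. w i))"
  shows "\<And>l. l \<in> J \<Longrightarrow> 0 < s l" and "\<And>T. T \<subseteq> J \<Longrightarrow> (\<Sum>l\<in>T. s l) < 1"
proof -
  have W: "0 \<le> (\<Sum>i\<in>J. w i)"
    using assms(2) by (simp add: sum_nonneg less_imp_le)
  show pos: "0 < s l" if "l \<in> J" for l
    using W that assms by (simp add: add_pos_nonneg)
  show "(\<Sum>l\<in>T. s l) < 1" if "T \<subseteq> J" for T
  proof -
    have "(\<Sum>l\<in>T. s l) \<le> (\<Sum>l\<in>J. s l)"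
      using that assms(1) pos by (intro sum_mono2) (auto intro: less_imp_le)
    also have "\<dots> = (\<Sum>i\<in>J. w i) / (1 + (\<Sum>i\<in>J. w i))"
      using s by (simp add: sum_divide_distrib)
    also have "\<dots> < 1" using W by simp
    finally show ?thesis .
  qed
qed

lemma mnl_shares:
  fixes \<alpha> :: real and v :: "'j \<Rightarrow> real"
  assumes "finite J" and "0 < N"
  defines "q \<equiv> mnl_demand J \<alpha> N v"
  shows "\<And>l. l \<in> J \<Longrightarrow> 0 < mnl_share q N p l"
    and "\<And>T. T \<subseteq> J \<Longrightarrow> (\<Sum>l\<in>T. mnl_share q N p l) < 1"
proof -
  have s: "mnl_share q N p l = exp (v l - \<alpha> * p l) / (1 + (\<Sum>i\<in>J. exp (v i - \<alpha> * p i)))" for l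
    using assms(2) by (simp add: mnl_share_def q_def mnl_demand_def)
  show "\<And>l. l \<in> J \<Longrightarrow> 0 < mnl_share q N p l"
    and "\<And>T. T \<subseteq> J \<Longrightarrow> (\<Sum>l\<in>T. mnl_share q N p l) < 1"
    using attraction_shares[OF assms(1) _ s] by simp_all
qed

lemma ces_shares:
  fixes \<sigma> :: real and v :: "'j \<Rightarrow> real"
  assumes "finite J" and "0 < Y" and pos: "\<forall>l\<in>J. 0 < p l" "\<forall>l\<in>J. 0 < v l"
  defines "q \<equiv> ces_demand J \<sigma> Y v"
  shows "\<And>l. l \<in> J \<Longrightarrow> 0 < ces_share q Y p l"
    and "\<And>T. T \<subseteq> J \<Longrightarrow> (\<Sum>l\<in>T. ces_share q Y p l) < 1"
proof -
  have s: "ces_share q Y p l = v l * p l powr (1 - \<sigma>) / (1 + (\<Sum>i\<in>J. v i * p i powr (1 - \<sigma>)))"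
    if "l \<in> J" for l
  proof -
    \<comment> \<open>Multiplying demand by price turns its numerator into the summand of the
      denominator, so revenue shares, not quantity shares, have the form
      \<open>w l / (1 + W)\<close>.\<close>
    have "p l * p l powr (- \<sigma>) = p l powr (1 - \<sigma>)"
      using bspec[OF pos(1) that] powr_add[of "p l" 1 "- \<sigma>"] by simp
    then show ?thesis
      using assms(2) by (simp add: ces_share_def q_def ces_demand_def mult.left_commute)
  qed
  have w: "0 < v l * p l powr (1 - \<sigma>)" if "l \<in> J" for l
    using pos that by (smt (verit) mult_pos_pos powr_gt_zero)
  show "\<And>l. l \<in> J \<Longrightarrow> 0 < ces_share q Y p l"
    and "\<And>T. T \<subseteq> J \<Longrightarrow> (\<Sum>l\<in>T. ces_share q Y p l) < 1"
    using attraction_shares[OF assms(1) w s] by simp_all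
qed

section \<open>Share-weighted margins in equilibrium\<close>

text \<open>Weighting the conditions by \<open>s j\<close> and summing closes the system:
  \<open>X\<close>, the weighted sum of margins, satisfies the scalar equation
  \<open>\<kappa> * X = (a + X) * S\<close>, with \<open>S\<close> the sum of shares, and
  \<open>S \<noteq> \<kappa>\<close> allows solving it.\<close>

lemma uniform_markup_sum:
  fixes m s :: "'j \<Rightarrow> real"
  assumes "\<And>j. j \<in> T \<Longrightarrow> \<kappa> * m j = a + (\<Sum>l\<in>T. m l * s l)"
    and "(\<Sum>l\<in>T. s l) \<noteq> \<kappa>"
  shows "(\<Sum>l\<in>T. m l * s l) = a * ((\<Sum>l\<in>T. s l) / (\<kappa> - (\<Sum>l\<in>T. s l)))"
proof -
  let ?X = "\<Sum>l\<in>T. m l * s l"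
  have "\<kappa> * ?X = (\<Sum>l\<in>T. (\<kappa> * m l) * s l)"
    by (simp add: sum_distrib_left mult.assoc)
  also have "\<dots> = (a + ?X) * (\<Sum>l\<in>T. s l)"
    using assms(1) by (simp add: sum_distrib_left)
  finally show ?thesis
    using assms(2) by (simp add: field_simps)
qed

lemma mnl_margin_sum:
  fixes \<alpha> :: real and v :: "'j \<Rightarrow> real"
  assumes "finite J" and "0 < \<alpha>" and "0 < N" and f: "f \<in> F" "Jf f \<subseteq> J"
  defines "q \<equiv> mnl_demand J \<alpha> N v"
  assumes eq: "bertrand_nash q c J F Jf p"
  defines "s \<equiv> mnl_share q N p"
  shows "(\<Sum>l\<in>Jf f. (p l - c l) * s l) = 1 / \<alpha> * ((\<Sum>l\<in>Jf f. s l) / (1 - (\<Sum>l\<in>Jf f. s l)))"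
proof (rule uniform_markup_sum)
  have fin: "finite (Jf f)" using assms(1) f(2) finite_subset by blast
  show "(\<Sum>l\<in>Jf f. s l) \<noteq> 1"
    using mnl_shares(2)[OF assms(1,3) f(2), of \<alpha> v p] by (simp add: s_def q_def)
  fix j assume j: "j \<in> Jf f"
  have sj: "0 < s j"
    using mnl_shares(1)[OF assms(1,3), of j \<alpha> v p] j f(2) by (auto simp: s_def q_def)
  have Ns: "q p l = N * s l" for l
    using assms(3) by (simp add: s_def mnl_share_def)
  have "q p j + (\<Sum>l\<in>Jf f. (p l - c l) * (\<alpha> * q p l * (s j - of_bool (l = j)))) = 0"
  proof (rule bertrand_nash_foc[OF eq f(1) fin f(2) j])
    show "((\<lambda>x. q (p(j := x)) l) has_real_derivative \<alpha> * q p l * (s j - of_bool (l = j))) (at (p j))" for l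
      unfolding q_def s_def by (rule mnl_demand_deriv) (use assms(1,3) f(2) j in auto)
  qed
  \<comment> \<open>Since \<open>q p l = N * s l\<close>, every term carries the factor
    \<open>\<alpha> * N * s j\<close>; the own-price term of \<open>j\<close> is split off as a
    conditional so that the rest is the weighted sum of margins.\<close>
  also have "(\<Sum>l\<in>Jf f. (p l - c l) * (\<alpha> * q p l * (s j - of_bool (l = j)))) =
      (\<Sum>l\<in>Jf f. \<alpha> * N * s j * ((p l - c l) * s l) -
        (if l = j then \<alpha> * N * s j * (p j - c j) else 0))"
    by (rule sum.cong) (auto simp: Ns algebra_simps)
  also have "\<dots> = \<alpha> * N * s j * ((\<Sum>l\<in>Jf f. (p l - c l) * s l) - (p j - c j))"
    using fin j by (simp add: sum_subtractf sum_distrib_left right_diff_distrib)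
  finally have "N * s j * (1 + \<alpha> * ((\<Sum>l\<in>Jf f. (p l - c l) * s l) - (p j - c j))) = 0"
    by (simp add: Ns algebra_simps)
  then have "1 + \<alpha> * ((\<Sum>l\<in>Jf f. (p l - c l) * s l) - (p j - c j)) = 0"
    using sj assms(3) by simp
  then show "1 * (p j - c j) = 1 / \<alpha> + (\<Sum>l\<in>Jf f. (p l - c l) * s l)"
    using assms(2) by (simp add: field_simps)
qed

lemma ces_margin_sum:
  fixes \<sigma> :: real and v :: "'j \<Rightarrow> real"
  assumes "finite J" and "1 < \<sigma>" and "0 < Y" and v: "\<forall>l\<in>J. 0 < v l" and f: "f \<in> F" "Jf f \<subseteq> J"
  defines "q \<equiv> ces_demand J \<sigma> Y v"
  assumes eq: "bertrand_nash q c J F Jf p"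
  defines "s \<equiv> ces_share q Y p" and "\<kappa> \<equiv> \<sigma> / (\<sigma> - 1)"
  shows "(\<Sum>l\<in>Jf f. relative_margin c p l * s l) =
          1 / (\<sigma> - 1) * ((\<Sum>l\<in>Jf f. s l) / (\<kappa> - (\<Sum>l\<in>Jf f. s l)))"
proof (rule uniform_markup_sum)
  have fin: "finite (Jf f)" using assms(1) f(2) finite_subset by blast
  have p: "\<forall>l\<in>J. 0 < p l" using eq by (simp add: bertrand_nash_def)
  have "1 < \<kappa>" using assms(2) by (simp add: \<kappa>_def)
  then show "(\<Sum>l\<in>Jf f. s l) \<noteq> \<kappa>"
    using ces_shares(2)[OF assms(1,3) p v f(2), of \<sigma>] by (simp add: s_def q_def)
  fix j assume j: "j \<in> Jf f"
  have sj: "0 < s j"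
    using ces_shares(1)[OF assms(1,3) p v, of j \<sigma>] j f(2) by (auto simp: s_def q_def)
  have pj: "0 < p j" using p j f(2) by blast
  let ?m = "relative_margin c p"
  have Ys: "q p l = Y * s l / p l" "p l - c l = p l * ?m l" "p l \<noteq> 0" if "l \<in> Jf f" for l
    using assms(3) p f(2) that by (fastforce simp: s_def ces_share_def relative_margin_def)+
  have "q p j + (\<Sum>l\<in>Jf f. (p l - c l) * (q p l / p j * ((\<sigma> - 1) * s j - \<sigma> * of_bool (l = j)))) = 0"
  proof (rule bertrand_nash_foc[OF eq f(1) fin f(2) j])
    show "((\<lambda>x. q (p(j := x)) l) has_real_derivative
        q p l / p j * ((\<sigma> - 1) * s j - \<sigma> * of_bool (l = j))) (at (p j))" for l
      unfolding q_def s_def by (rule ces_demand_deriv) (use assms(1,3) f(2) j p v in auto)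
  qed
  also have "(\<Sum>l\<in>Jf f. (p l - c l) * (q p l / p j * ((\<sigma> - 1) * s j - \<sigma> * of_bool (l = j)))) =
      (\<Sum>l\<in>Jf f. Y * s j / p j * (\<sigma> - 1) * (?m l * s l) -
        (if l = j then Y * s j / p j * (\<sigma> * ?m j) else 0))"
  proof (rule sum.cong[OF refl])
    fix l assume l: "l \<in> Jf f"
    \<comment> \<open>The price of \<open>l\<close> cancels: margin times quantity is relative
      margin times revenue, \<open>Y * ?m l * s l\<close>.\<close>
    have m: "(p l - c l) * (q p l / p j * x) = Y / p j * (?m l * s l) * x" for x
      using Ys[OF l] by simp
    show "(p l - c l) * (q p l / p j * ((\<sigma> - 1) * s j - \<sigma> * of_bool (l = j))) =
        Y * s j / p j * (\<sigma> - 1) * (?m l * s l) - (if l = j then Y * s j / p j * (\<sigma> * ?m j) else 0)"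
      unfolding m by (auto simp: algebra_simps add_divide_distrib diff_divide_distrib)
  qed
  also have "\<dots> = Y * s j / p j * ((\<sigma> - 1) * (\<Sum>l\<in>Jf f. ?m l * s l) - \<sigma> * ?m j)"
    unfolding sum_subtractf sum_distrib_left[symmetric] using fin j
    by (simp add: algebra_simps diff_divide_distrib)
  \<comment> \<open>The leading term \<open>q p j\<close> equals \<open>Y * s j / p j\<close>, a
    positive factor common to the whole condition, which is then cancelled.\<close>
  finally have "Y * s j / p j * (1 + ((\<sigma> - 1) * (\<Sum>l\<in>Jf f. ?m l * s l) - \<sigma> * ?m j)) = 0"
    using Ys(1)[OF j] by (simp only: distrib_left mult_1_right)
  then have "1 + ((\<sigma> - 1) * (\<Sum>l\<in>Jf f. ?m l * s l) - \<sigma> * ?m j) = 0"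
    using sj assms(3) pj by simp
  then show "\<kappa> * ?m j = 1 / (\<sigma> - 1) + (\<Sum>l\<in>Jf f. ?m l * s l)"
    using assms(2) by (simp add: \<kappa>_def field_simps)
qed

section \<open>Diversion ratios in terms of shares\<close>

lemma partial_eq:
  assumes "((\<lambda>x. G (p(k := x))) has_real_derivative d) (at (p k))"
  shows "partial G k p = d"
  using assms unfolding partial_def by (rule DERIV_imp_deriv)

text \<open>The ratio of derivatives is \<open>q p l * s j\<close> over
  \<open>q p j * (s j - 1)\<close>, where \<open>s\<close> denotes the shares; as
  \<open>q p j\<close> is proportional to \<open>s j\<close>, the latter cancels.\<close>

lemma mnl_diversion:
  fixes \<alpha> :: real and v :: "'j \<Rightarrow> real"
  assumes "finite J" and "0 < \<alpha>" and "0 < N" and "j \<in> J" and "l \<noteq> j"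
  defines "q \<equiv> mnl_demand J \<alpha> N v"
  shows "diversion q p j l = mnl_share q N p l / (1 - mnl_share q N p j)"
proof -
  have d: "partial (\<lambda>p. q p i) j p = \<alpha> * q p i * (mnl_share q N p j - of_bool (i = j))" for i
    unfolding q_def by (rule partial_eq[OF mnl_demand_deriv]) (use assms in auto)
  have "0 < mnl_share q N p j" "mnl_share q N p j < 1"
    using mnl_shares(1)[OF assms(1,3), of j \<alpha> v p] mnl_shares(2)[OF assms(1,3), of "{j}" \<alpha> v p] assms(4)
    by (auto simp: q_def)
  moreover have "q p i = N * mnl_share q N p i" for i
    using assms(3) by (simp add: mnl_share_def)
  ultimately show ?thesis
    using assms(2,3,5) unfolding diversion_def d by (simp add: divide_simps) (simp add: algebra_simps)
qed

text \<open>Taking \<open>\<sigma> - 1\<close> out of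
  \<open>\<sigma> - (\<sigma> - 1) * s j\<close>, with \<open>s\<close> the revenue shares, leaves
  \<open>\<kappa> - s j\<close>. The price ratio appears because this is diversion of quantities
  expressed in revenue shares.\<close>

lemma ces_diversion:
  fixes \<sigma> :: real and v :: "'j \<Rightarrow> real"
  assumes "finite J" and "1 < \<sigma>" and "0 < Y" and pos: "\<forall>l\<in>J. 0 < p l" "\<forall>l\<in>J. 0 < v l"
    and "j \<in> J" and "l \<in> J" and "l \<noteq> j"
  defines "q \<equiv> ces_demand J \<sigma> Y v" and "\<kappa> \<equiv> \<sigma> / (\<sigma> - 1)"
  shows "diversion q p j l = p j / p l * (ces_share q Y p l / (\<kappa> - ces_share q Y p j))"
proof -
  let ?s = "ces_share q Y p"
  have d: "partial (\<lambda>p. q p i) j p = q p i / p j * ((\<sigma> - 1) * ?s j - \<sigma> * of_bool (i = j))" for i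
    unfolding q_def by (rule partial_eq[OF ces_demand_deriv]) (use assms in auto)
  have s: "0 < ?s j" "?s j < 1"
    using ces_shares(1)[OF assms(1,3) pos, of j \<sigma>] ces_shares(2)[OF assms(1,3) pos, of "{j}" \<sigma>] assms(6)
    by (auto simp: q_def)
  have p: "0 < p j" "0 < p l" using pos assms by auto
  have "(\<sigma> - 1) * ?s j < \<sigma> - 1" using s assms(2) by simp
  then have ne: "(\<sigma> - 1) * ?s j - \<sigma> \<noteq> 0" by simp
  have \<kappa>: "\<kappa> - ?s j = - ((\<sigma> - 1) * ?s j - \<sigma>) / (\<sigma> - 1)"
    using assms(2) by (simp add: \<kappa>_def field_simps)
  have q: "q p j = Y * ?s j / p j" "q p l = Y * ?s l / p l"
    using assms(3) p by (simp_all add: ces_share_def)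
  show ?thesis
    using s p ne assms(2,3,8) unfolding diversion_def d \<kappa> q
    by (simp add: divide_simps) (simp add: algebra_simps)
qed

section \<open>The algebraic identity behind both formulas\<close>

text \<open>The identity holds entry by entry in \<open>M\<close>. For \<open>l\<close> in
  \<open>SA\<close>, the weight of the entry cancels \<open>s l\<close>, \<open>sA\<close> and
  \<open>\<kappa> - sA\<close> and leaves \<open>sB / (\<kappa> - sB) / (\<kappa> - s l)\<close>;
  the halves absorb the 2 of \<open>2 * sA * sB\<close>, and \<open>1 / \<kappa>\<close> absorbs the
  numerator \<open>\<kappa>\<close>. The case of \<open>SB\<close> is symmetric.\<close>

lemma merger_identity:
  fixes s :: "'j \<Rightarrow> real" and M :: "'j \<Rightarrow> 'j \<Rightarrow> real"
  assumes "finite SA" and "finite SB" and "SA \<inter> SB = {}"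
    and s: "\<And>l. l \<in> SA \<union> SB \<Longrightarrow> 0 < s l \<and> s l < \<kappa>"
    and sA: "sA = (\<Sum>l\<in>SA. s l)" "0 < sA" "sA < \<kappa>"
    and sB: "sB = (\<Sum>l\<in>SB. s l)" "0 < sB" "sB < \<kappa>"
    and U: "\<And>k. k \<in> SA \<union> SB \<Longrightarrow>
      U k = a * (if k \<in> SA then sB / (\<kappa> - sB) else sA / (\<kappa> - sA)) / (\<kappa> - s k)"
  shows "(\<Sum>j\<in>SA \<union> SB. \<Sum>k\<in>SA \<union> SB. M j k * U k * s j) =
    a * (\<kappa> / ((\<kappa> - sA) * (\<kappa> - sB))) *
    (\<Sum>j\<in>SA \<union> SB. \<Sum>l\<in>SA \<union> SB. 1 / \<kappa> * M j l * (s j / s l) *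
       (1 / 2 * indicator SA l * ((s l / (\<kappa> - s l)) / (sA / (\<kappa> - sA))) +
        1 / 2 * indicator SB l * ((s l / (\<kappa> - s l)) / (sB / (\<kappa> - sB))))) * (2 * sA * sB)"
    (is "?L = ?C * (\<Sum>j\<in>_. \<Sum>l\<in>_. ?R j l) * ?H")
proof -
  have "M j l * U l * s j = ?C * ?R j l * ?H" if "l \<in> SA \<union> SB" for j l
  proof -
    have "0 < s l" "0 < \<kappa> - s l" "0 < \<kappa> - sA" "0 < \<kappa> - sB" "0 < \<kappa>"
      using s[OF that] sA sB by auto
    \<comment> \<open>By disjointness exactly one of the two indicators is 1, so a single summand of
      the weight survives.\<close>
    moreover have "l \<in> SA \<and> l \<notin> SB \<or> l \<notin> SA \<and> l \<in> SB" using that assms(3) by blast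
    ultimately show ?thesis
      using sA(2) sB(2) U[OF that] by (elim disjE) (simp_all add: indicator_def)
  qed
  then show ?thesis
    by (simp add: sum_distrib_left sum_distrib_right)
qed

section \<open>Assembly for the two demand systems\<close>

theorem proposition1:
  fixes J :: "'j set" and F :: "'f set" and Jf :: "'f \<Rightarrow> 'j set"
    and c :: "'j \<Rightarrow> real" and A B :: 'f
  assumes "finite J"
    and "product_partition J F Jf"
    and "\<forall>l\<in>J. 0 < c l"
    and "A \<in> F" and "B \<in> F" and "A \<noteq> B"
  shows
    "(\<forall>(\<alpha>::real) (N::real) (v::'j \<Rightarrow> real) (p::'j \<Rightarrow> real).
        let q = mnl_demand J \<alpha> N v;
            S = Jf A \<union> Jf B;
            M = mnl_pass_through q c S p;
            s = mnl_share q N p;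
            sA = (\<Sum>j\<in>Jf A. s j);
            sB = (\<Sum>j\<in>Jf B. s j);
            V0 = N / \<alpha>;
            \<rho>1 = 1 / ((1 - sA) * (1 - sB));
            \<rho>2 = (\<Sum>j\<in>S. \<Sum>l\<in>S. M j l * (s j / s l) *
                   (1 / 2 * indicator (Jf A) l * ((s l / (1 - s l)) / (sA / (1 - sA))) +
                    1 / 2 * indicator (Jf B) l * ((s l / (1 - s l)) / (sB / (1 - sB)))));
            \<Delta>HHI = 2 * sA * sB
        in 0 < \<alpha> \<and> 0 < N \<and> bertrand_nash q c J F Jf p \<and>
           invertible_on S (mnl_jacobian q c S p) \<longrightarrow>
           delta_CS q S p (mnl_price_change q c (Jf A) (Jf B) p) = - V0 * \<rho>1 * \<rho>2 * \<Delta>HHI)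
     \<and>
     (\<forall>(\<sigma>::real) (Y::real) (v::'j \<Rightarrow> real) (p::'j \<Rightarrow> real).
        let q = ces_demand J \<sigma> Y v;
            S = Jf A \<union> Jf B;
            M = ces_pass_through q c S p;
            s = ces_share q Y p;
            sA = (\<Sum>j\<in>Jf A. s j);
            sB = (\<Sum>j\<in>Jf B. s j);
            \<kappa> = \<sigma> / (\<sigma> - 1);
            V0 = Y / (\<sigma> - 1);
            \<rho>1 = \<kappa> / ((\<kappa> - sA) * (\<kappa> - sB));
            \<rho>2 = (\<Sum>j\<in>S. \<Sum>l\<in>S. (\<sigma> - 1) / \<sigma> * M j l * (s j / s l) *
                   (1 / 2 * indicator (Jf A) l * ((s l / (\<kappa> - s l)) / (sA / (\<kappa> - sA))) +
                    1 / 2 * indicator (Jf B) l * ((s l / (\<kappa> - s l)) / (sB / (\<kappa> - sB)))));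
            \<Delta>HHI = 2 * sA * sB
        in 1 < \<sigma> \<and> 0 < Y \<and> (\<forall>l\<in>J. 0 < v l) \<and> bertrand_nash q c J F Jf p \<and>
           invertible_on S (ces_jacobian q c S p) \<longrightarrow>
           delta_CS q S p (ces_price_change q c (Jf A) (Jf B) p) = - V0 * \<rho>1 * \<rho>2 * \<Delta>HHI)"
proof -
  let ?S = "Jf A \<union> Jf B"
  have sub: "Jf A \<subseteq> J" "Jf B \<subseteq> J" "Jf A \<noteq> {}" "Jf B \<noteq> {}" "Jf A \<inter> Jf B = {}"
    using assms(2,4-6) by (auto simp: product_partition_def disjoint_family_on_def)
  have fin: "finite (Jf A)" "finite (Jf B)"
    using sub assms(1) finite_subset by blast+
  have mnl: "delta_CS q ?S p (mnl_price_change q c (Jf A) (Jf B) p) =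
      - (N / \<alpha>) * (1 / ((1 - sA) * (1 - sB))) *
      (\<Sum>j\<in>?S. \<Sum>l\<in>?S. M j l * (s j / s l) *
         (1 / 2 * indicator (Jf A) l * ((s l / (1 - s l)) / (sA / (1 - sA))) +
          1 / 2 * indicator (Jf B) l * ((s l / (1 - s l)) / (sB / (1 - sB))))) * (2 * sA * sB)"
    if \<alpha>: "0 < \<alpha>" and N: "0 < N"
      and q: "q = mnl_demand J \<alpha> N v" and eq: "bertrand_nash q c J F Jf p"
      and M: "M = mnl_pass_through q c ?S p" and s: "s = mnl_share q N p"
      and sA: "sA = (\<Sum>j\<in>Jf A. s j)" and sB: "sB = (\<Sum>j\<in>Jf B. s j)"
    for \<alpha> N q v p M s sA sB
  proof -
    have s0: "0 < s l" if "l \<in> J" for l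
      using mnl_shares(1)[OF assms(1) N that] by (simp add: s q)
    have s1: "(\<Sum>l\<in>T. s l) < 1" if "T \<subseteq> J" for T
      using mnl_shares(2)[OF assms(1) N that] by (simp add: s q)
    have U: "UPP q c (Jf A) (Jf B) p k =
        1 / \<alpha> * (if k \<in> Jf A then sB / (1 - sB) else sA / (1 - sA)) / (1 - s k)"
      if k: "k \<in> ?S" for k
    proof -
      \<comment> \<open>Stated for any firm not owning \<open>k\<close>, so that it serves for
        \<open>A\<close> and for \<open>B\<close>. Diversion has the factor
        \<open>1 / (1 - s k)\<close> for every \<open>l\<close>, and the remaining sum is known from
        the equilibrium conditions of \<open>f\<close> itself.\<close>
      have div: "(\<Sum>l\<in>Jf f. (p l - c l) * diversion q p k l) =
          1 / \<alpha> * ((\<Sum>l\<in>Jf f. s l) / (1 - (\<Sum>l\<in>Jf f. s l))) / (1 - s k)"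
        if "f \<in> F" "Jf f \<subseteq> J" "k \<notin> Jf f" for f
      proof -
        have "diversion q p k l = s l / (1 - s k)" if "l \<in> Jf f" for l
          using mnl_diversion[OF assms(1) \<alpha> N, of k l v p] that \<open>k \<notin> Jf f\<close> k sub by (auto simp: q s)
        then have "(\<Sum>l\<in>Jf f. (p l - c l) * diversion q p k l) =
            (\<Sum>l\<in>Jf f. (p l - c l) * s l) / (1 - s k)"
          by (simp add: sum_divide_distrib)
        then show ?thesis
          using mnl_margin_sum[where Jf = Jf, OF assms(1) \<alpha> N that(1,2), of v c p] eq by (simp add: q s)
      qed
      show ?thesis
        using k sub assms(4,5) div[of A] div[of B] by (auto simp: UPP_def sA sB mult_ac)
    qed
    have "delta_CS q ?S p (mnl_price_change q c (Jf A) (Jf B) p) =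
        - N * (\<Sum>j\<in>?S. \<Sum>k\<in>?S. M j k * UPP q c (Jf A) (Jf B) p k * s j)"
      using N by (simp add: delta_CS_def mnl_price_change_def M s mnl_share_def sum_distrib_left
          sum_distrib_right flip: sum_negf)
    \<comment> \<open>This is the identity at \<open>\<kappa> = 1\<close>; the factor
      \<open>1 / 1\<close> is the instance of \<open>1 / \<kappa>\<close>.\<close>
    also have "(\<Sum>j\<in>?S. \<Sum>k\<in>?S. M j k * UPP q c (Jf A) (Jf B) p k * s j) =
        1 / \<alpha> * (1 / ((1 - sA) * (1 - sB))) *
        (\<Sum>j\<in>?S. \<Sum>l\<in>?S. 1 / 1 * M j l * (s j / s l) *
          (1 / 2 * indicator (Jf A) l * ((s l / (1 - s l)) / (sA / (1 - sA))) +
           1 / 2 * indicator (Jf B) l * ((s l / (1 - s l)) / (sB / (1 - sB))))) * (2 * sA * sB)"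
    proof (rule merger_identity[OF fin sub(5) _ sA _ _ sB])
      show "0 < s l \<and> s l < 1" if "l \<in> ?S" for l
        using s0[of l] s1[of "{l}"] that sub by auto
      show "0 < sA" "0 < sB"
        unfolding sA sB using fin sub s0 by (auto intro!: sum_pos)
      show "sA < 1" "sB < 1"
        unfolding sA sB using s1 sub by auto
    qed (rule U)
    finally show ?thesis by simp
  qed
  have ces: "delta_CS q ?S p (ces_price_change q c (Jf A) (Jf B) p) =
      - (Y / (\<sigma> - 1)) * (\<kappa> / ((\<kappa> - sA) * (\<kappa> - sB))) *
      (\<Sum>j\<in>?S. \<Sum>l\<in>?S. (\<sigma> - 1) / \<sigma> * M j l * (s j / s l) *
         (1 / 2 * indicator (Jf A) l * ((s l / (\<kappa> - s l)) / (sA / (\<kappa> - sA))) +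
          1 / 2 * indicator (Jf B) l * ((s l / (\<kappa> - s l)) / (sB / (\<kappa> - sB))))) * (2 * sA * sB)"
    if \<sigma>: "1 < \<sigma>" and Y: "0 < Y" and v: "\<forall>l\<in>J. 0 < v l"
      and q: "q = ces_demand J \<sigma> Y v" and eq: "bertrand_nash q c J F Jf p"
      and M: "M = ces_pass_through q c ?S p" and s: "s = ces_share q Y p"
      and sA: "sA = (\<Sum>j\<in>Jf A. s j)" and sB: "sB = (\<Sum>j\<in>Jf B. s j)" and \<kappa>: "\<kappa> = \<sigma> / (\<sigma> - 1)"
    for \<sigma> Y q v p M s sA sB \<kappa>
  proof -
    have p: "\<forall>l\<in>J. 0 < p l" using eq by (simp add: bertrand_nash_def)
    have \<kappa>1: "1 < \<kappa>" "1 / \<kappa> = (\<sigma> - 1) / \<sigma>" using \<sigma> by (simp_all add: \<kappa>)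
    have s0: "0 < s l" if "l \<in> J" for l
      using ces_shares(1)[OF assms(1) Y p v that] by (simp add: s q)
    \<comment> \<open>Sums of shares stay below 1, hence below \<open>\<kappa>\<close>, which is the
      bound that the identity asks for.\<close>
    have s1: "(\<Sum>l\<in>T. s l) < \<kappa>" if "T \<subseteq> J" for T
      using ces_shares(2)[OF assms(1) Y p v that, of \<sigma>] \<kappa>1 by (simp add: s q)
    have U: "GUPPI q c (Jf A) (Jf B) p k =
        1 / (\<sigma> - 1) * (if k \<in> Jf A then sB / (\<kappa> - sB) else sA / (\<kappa> - sA)) / (\<kappa> - s k)"
      if k: "k \<in> ?S" for k
    proof -
      have div: "(\<Sum>l\<in>Jf f. (p l - c l) * diversion q p k l) / p k =
          1 / (\<sigma> - 1) * ((\<Sum>l\<in>Jf f. s l) / (\<kappa> - (\<Sum>l\<in>Jf f. s l))) / (\<kappa> - s k)"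
        if "f \<in> F" "Jf f \<subseteq> J" "k \<notin> Jf f" for f
      proof -
        \<comment> \<open>Dividing by \<open>p k\<close>, as GUPPI does, cancels the numerator of
          the price ratio in the diversion; its denominator \<open>p l\<close> makes the margin of
          \<open>l\<close> relative.\<close>
        have "(p l - c l) * diversion q p k l / p k = relative_margin c p l * s l / (\<kappa> - s k)"
          if l: "l \<in> Jf f" for l
        proof -
          have kl: "k \<in> J" "l \<in> J" "l \<noteq> k" using l \<open>k \<notin> Jf f\<close> \<open>Jf f \<subseteq> J\<close> k sub by auto
          have "diversion q p k l = p k / p l * (s l / (\<kappa> - s k))"
            using ces_diversion[OF assms(1) \<sigma> Y p v kl] by (simp add: q s \<kappa>)
          moreover have "p k \<noteq> 0" using p kl by fastforce
          ultimately show ?thesis by (simp add: relative_margin_def)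
        qed
        then have "(\<Sum>l\<in>Jf f. (p l - c l) * diversion q p k l) / p k =
            (\<Sum>l\<in>Jf f. relative_margin c p l * s l) / (\<kappa> - s k)"
          by (simp add: sum_divide_distrib)
        then show ?thesis
          using ces_margin_sum[where Jf = Jf, OF assms(1) \<sigma> Y v that(1,2), of c p] eq by (simp add: q s \<kappa>)
      qed
      show ?thesis
        using k sub assms(4,5) div[of A] div[of B] by (auto simp: GUPPI_def UPP_def sA sB mult_ac)
    qed
    \<comment> \<open>Predicted changes are relative to \<open>p j\<close>, and
      \<open>p j * q p j\<close> is \<open>Y * s j\<close>; this brings in revenue shares.\<close>
    have "delta_CS q ?S p (ces_price_change q c (Jf A) (Jf B) p) =
        - Y * (\<Sum>j\<in>?S. \<Sum>k\<in>?S. M j k * GUPPI q c (Jf A) (Jf B) p k * s j)"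
      using Y by (simp add: delta_CS_def ces_price_change_def M s ces_share_def sum_distrib_left
          sum_distrib_right mult_ac flip: sum_negf)
    also have "(\<Sum>j\<in>?S. \<Sum>k\<in>?S. M j k * GUPPI q c (Jf A) (Jf B) p k * s j) =
        1 / (\<sigma> - 1) * (\<kappa> / ((\<kappa> - sA) * (\<kappa> - sB))) *
        (\<Sum>j\<in>?S. \<Sum>l\<in>?S. 1 / \<kappa> * M j l * (s j / s l) *
          (1 / 2 * indicator (Jf A) l * ((s l / (\<kappa> - s l)) / (sA / (\<kappa> - sA))) +
           1 / 2 * indicator (Jf B) l * ((s l / (\<kappa> - s l)) / (sB / (\<kappa> - sB))))) * (2 * sA * sB)"
    proof (rule merger_identity[OF fin sub(5) _ sA _ _ sB])
      show "0 < s l \<and> s l < \<kappa>" if "l \<in> ?S" for l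
        using s0[of l] s1[of "{l}"] that sub by auto
      show "0 < sA" "0 < sB"
        unfolding sA sB using fin sub s0 by (auto intro!: sum_pos)
      show "sA < \<kappa>" "sB < \<kappa>"
        unfolding sA sB using s1 sub by auto
    qed (rule U)
    finally show ?thesis unfolding \<kappa>1(2) by simp
  qed
  \<comment> \<open>Both claims were stated with each abbreviation as a variable constrained by an
    equation; once the \<open>let\<close> bindings are unfolded, these equations hold by
    reflexivity.\<close>
  show ?thesis
    unfolding Let_def by (intro conjI allI impI mnl ces; (elim conjE)?; (assumption | rule refl)?)
qed

end
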